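(* Let $n\ge 1$. The following set of $H$-chromatic symmetric functions is a basis for $\Lambda^n$: $$\beta = \{ X_{K_\lambda}^{K_{l(\lambda)}} : \lambda = (\lambda_1, \lambda_2, \dots, \lambda_k) \vdash n,\ \lambda \neq (n) \} \cup \{ X_{\overline{K_n}}^{K_1} \}.$$
   Context: All graphs are finite, simple, undirected, with at least one vertex. $\Lambda^n$ is the vector space (over $\mathbb{Q}$) of homogeneous symmetric functions of degree $n$. For a partition $\lambda=(\lambda_1,\dots,\lambda_k)$, $l(\lambda)=k$ is its number of parts; $K_\lambda=K_{\lambda_1,\dots,\lambda_k}$ is the complete $k$-partite graph with parts of sizes $\lambda_1,\dots,\lambda_k$. $K_n$ is the complete graph on $n$ vertices and $\overline{K_n}$ is the edgeless graph on $n$ vertices. $H$-chromatic symmetric function: let $G,H$ be graphs with $|V(G)|=k$, $|V(H)|=N$. A labeling of $H$ is a bijection $\phi:V(H)\to[N]$. A proper $(H,\phi)$-coloring of $G$ is a map $\kappa:V(G)\to[N]$ such that whenever $u,v$ are adjacent in $G$, $\phi^{-1}(\kappa(u))$ and $\phi^{-1}(\kappa(v))$ are adjacent in $H$. Put $w_G^H=\sum_\phi\sum_\kappa\prod_{v\in V(G)}x_{\kappa(v)}$, summed over all labelings $\phi$ and all proper $(H,\phi)$-colorings $\kappa$. This is a symmetric polynomial in $x_1,\dots,x_N$, homogeneous of degree $k$; writing $w_G^H=\sum_{\lambda\vdash k,\,l(\lambda)\le N}c_\lambda m_\lambda(x_1,\dots,x_N)$ (with $m_\lambda$ the monomial symmetric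 functions), define $X_G^H=\sum_{\lambda\vdash k,\,l(\lambda)\le N}c_\lambda m_\lambda\in\Lambda^k$. *)

theory Defs
  imports
    "HOL-Library.Poly_Mapping"
    "HOL-Library.Function_Algebras"
    "HOL-Library.FuncSet"
    "HOL-Library.Multiset"
    "HOL-Combinatorics.Permutations"
    "Graph_Theory.Graph_Theory"
begin

section \<open>Integer partitions\<close>

definition partitions :: "nat \<Rightarrow> nat list set" where
  "partitions n = {lam. sorted_wrt (\<ge>) lam \<and> (\<forall>i\<in>set lam. 0 < i) \<and> sum_list lam = n}"

section \<open>Symmetric functions\<close>

text \<open>
  The variables are indexed by all natural numbers, so that \<open>x\<^sub>1, x\<^sub>2, \<dots>\<close> of the
  literature are \<open>x\<^sub>0, x\<^sub>1, \<dots>\<close> here, and \<open>[N]\<close> is \<open>{..<N}\<close>.  An exponent vector of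
  type \<open>nat \<Rightarrow>\<^sub>0 nat\<close> is a monomial; a formal power series in the variables is its
  coefficient function.  Only the vector space structure of power series is used: the
  pointwise product of functions is \<^emph>\<open>not\<close> the product of power series.
\<close>

type_synonym monomial = "nat \<Rightarrow>\<^sub>0 nat"
type_synonym mpoly = "monomial \<Rightarrow>\<^sub>0 rat"
type_synonym mseries = "monomial \<Rightarrow> rat"

definition mon_degree :: "monomial \<Rightarrow> nat" where
  "mon_degree a = (\<Sum>i\<in>Poly_Mapping.keys a. Poly_Mapping.lookup a i)"

text \<open>The multiset of the nonzero exponents.\<close>

definition exponents :: "monomial \<Rightarrow> nat multiset" where
  "exponents a = image_mset (Poly_Mapping.lookup a) (mset_set (Poly_Mapping.keys a))"

definition sf_scale :: "rat \<Rightarrow> mseries \<Rightarrow> mseries" where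
  "sf_scale c f = (\<lambda>a. c * f a)"

global_interpretation sf: vector_space sf_scale
  by standard (simp_all add: sf_scale_def fun_eq_iff algebra_simps)

definition Sym_hom :: "nat \<Rightarrow> mseries set" where
  "Sym_hom n = {f. (\<forall>a. f a \<noteq> 0 \<longrightarrow> mon_degree a = n) \<and>
                   (\<forall>p a. bij p \<longrightarrow> f (Poly_Mapping.map_key p a) = f a)}"

lemma subspace_Sym_hom: "sf.subspace (Sym_hom n)"
proof (rule sf.subspaceI)
  show "f + g \<in> Sym_hom n" if "f \<in> Sym_hom n" "g \<in> Sym_hom n" for f g
    using that by (auto simp: Sym_hom_def) (metis add.right_neutral)
qed (auto simp: Sym_hom_def sf_scale_def)

definition monomial_sf :: "nat list \<Rightarrow> mseries" where
  "monomial_sf lam = (\<lambda>a. if exponents a = mset lam then 1 else 0)"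

definition monomial_sp :: "nat \<Rightarrow> nat list \<Rightarrow> mpoly" where
  "monomial_sp N lam =
     (\<Sum>a | Poly_Mapping.keys a \<subseteq> {..<N} \<and> exponents a = mset lam. Poly_Mapping.single a 1)"

definition Var :: "nat \<Rightarrow> mpoly" where
  "Var i = Poly_Mapping.single (Poly_Mapping.single i 1) 1"

definition Const :: "rat \<Rightarrow> mpoly" where
  "Const c = Poly_Mapping.single 0 c"

section \<open>Graphs\<close>

text \<open>
  A finite simple undirected graph is a \<^locale>\<open>pair_graph\<close>: \<open>u\<close> and \<open>v\<close> are adjacent iff
  both \<open>(u, v)\<close> and \<open>(v, u)\<close> are arcs.
\<close>

definition complete_graph :: "nat \<Rightarrow> nat pair_pre_digraph" where
  "complete_graph n =
     \<lparr>pverts = {..<n}, parcs = {(u, v). u < n \<and> v < n \<and> u \<noteq> v}\<rparr>"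

definition edgeless_graph :: "nat \<Rightarrow> nat pair_pre_digraph" where
  "edgeless_graph n = \<lparr>pverts = {..<n}, parcs = {}\<rparr>"

text \<open>The vertex \<open>(i, j)\<close> is the \<open>j\<close>-th vertex of the \<open>i\<close>-th part.\<close>

definition complete_multipartite_graph :: "nat list \<Rightarrow> (nat \<times> nat) pair_pre_digraph" where
  "complete_multipartite_graph lam =
     (let V = {(i, j). i < length lam \<and> j < lam ! i}
      in \<lparr>pverts = V, parcs = {(u, v). u \<in> V \<and> v \<in> V \<and> fst u \<noteq> fst v}\<rparr>)"

lemma pair_graph_complete_graph: "pair_graph (complete_graph n)"
proof -
  have "finite {(u, v). u < n \<and> v < n \<and> u \<noteq> v}"
    by (rule finite_subset[of _ "{..<n} \<times> {..<n}"]) auto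
  then show ?thesis
    by unfold_locales
       (auto simp: complete_graph_def symmetric_def arcs_ends_def arc_to_ends_def sym_def)
qed

lemma complete_digraph_complete_graph: "complete_digraph n (with_proj (complete_graph n))"
  by (auto simp: complete_digraph_pair_def complete_graph_def)

lemma pair_graph_edgeless_graph: "pair_graph (edgeless_graph n)"
  by unfold_locales
     (auto simp: edgeless_graph_def symmetric_def arcs_ends_def arc_to_ends_def sym_def)

lemma complete_multipartite_verts:
  "pverts (complete_multipartite_graph lam) = Sigma {..<length lam} (\<lambda>i. {..<lam ! i})"
  by (auto simp: complete_multipartite_graph_def Let_def)

lemma pair_graph_complete_multipartite_graph: "pair_graph (complete_multipartite_graph lam)"
proof -
  let ?G = "complete_multipartite_graph lam"
  have fin: "finite (pverts ?G)"
    by (simp add: complete_multipartite_verts)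
  have "finite (parcs ?G)"
    by (rule finite_subset[of _ "pverts ?G \<times> pverts ?G"])
       (use fin in \<open>auto simp: complete_multipartite_graph_def Let_def\<close>)
  with fin show ?thesis
    by unfold_locales
       (auto simp: complete_multipartite_graph_def Let_def symmetric_def arcs_ends_def
          arc_to_ends_def sym_def)
qed

lemma card_complete_multipartite_verts:
  "card (pverts (complete_multipartite_graph lam)) = sum_list lam"
  by (simp add: complete_multipartite_verts sum_list_sum_nth atLeast0LessThan)

section \<open>The \<open>H\<close>-chromatic symmetric function\<close>

text \<open>
  Labelings and colorings are extensional functions, so that each of them is counted once.
\<close>

definition labelings :: "'b pair_pre_digraph \<Rightarrow> ('b \<Rightarrow> nat) set" where
  "labelings H =
     {phi \<in> pverts H \<rightarrow>\<^sub>E {..<card (pverts H)}. bij_betw phi (pverts H) {..<card (pverts H)}}"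

definition proper_colorings ::
  "'a pair_pre_digraph \<Rightarrow> 'b pair_pre_digraph \<Rightarrow> ('b \<Rightarrow> nat) \<Rightarrow> ('a \<Rightarrow> nat) set" where
  "proper_colorings G H phi =
     {kap \<in> pverts G \<rightarrow>\<^sub>E {..<card (pverts H)}.
        \<forall>(u, v) \<in> parcs G. (inv_into (pverts H) phi (kap u), inv_into (pverts H) phi (kap v)) \<in> parcs H}"

definition Hchrom_poly :: "'a pair_pre_digraph \<Rightarrow> 'b pair_pre_digraph \<Rightarrow> mpoly" where
  "Hchrom_poly G H =
     (\<Sum>phi\<in>labelings H. \<Sum>kap\<in>proper_colorings G H phi. \<Prod>v\<in>pverts G. Var (kap v))"

definition Hchrom_partitions :: "'a pair_pre_digraph \<Rightarrow> 'b pair_pre_digraph \<Rightarrow> nat list set" where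
  "Hchrom_partitions G H = {lam \<in> partitions (card (pverts G)). length lam \<le> card (pverts H)}"

text \<open>
  The unique coefficients \<open>c\<close> of the expansion of the \<open>H\<close>-chromatic polynomial in the monomial
  symmetric polynomials in \<open>card (pverts H)\<close> variables; see \<open>ex1_Hchrom_coeff\<close> below.
\<close>

definition Hchrom_coeff :: "'a pair_pre_digraph \<Rightarrow> 'b pair_pre_digraph \<Rightarrow> nat list \<Rightarrow> rat" where
  "Hchrom_coeff G H =
     (THE c. (\<forall>lam. lam \<notin> Hchrom_partitions G H \<longrightarrow> c lam = 0) \<and>
        Hchrom_poly G H =
          (\<Sum>lam\<in>Hchrom_partitions G H. Const (c lam) * monomial_sp (card (pverts H)) lam))"

definition Hchrom_sf :: "'a pair_pre_digraph \<Rightarrow> 'b pair_pre_digraph \<Rightarrow> mseries" where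
  "Hchrom_sf G H =
     (\<Sum>lam\<in>Hchrom_partitions G H. sf_scale (Hchrom_coeff G H lam) (monomial_sf lam))"

section \<open>Existence and uniqueness of the coefficients\<close>

lemma sum_mset_exponents: "\<Sum>\<^sub># (exponents a) = mon_degree a"
  by (simp add: exponents_def mon_degree_def sum_unfold_sum_mset)

lemma size_exponents: "size (exponents a) = card (Poly_Mapping.keys a)"
  by (simp add: exponents_def)

lemma exponents_pos: "i \<in># exponents a \<Longrightarrow> 0 < i"
  by (auto simp: exponents_def in_keys_iff)

lemma partition_mset_inj:
  assumes "lam \<in> partitions n" "mu \<in> partitions m" "mset lam = mset mu"
  shows "lam = mu"
proof -
  have "sorted (rev lam)" "sorted (rev mu)"
    using assms by (simp_all add: partitions_def sorted_wrt_rev)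
  moreover have "mset (rev lam) = mset (rev mu)" using assms by simp
  ultimately have "rev lam = rev mu" by (metis properties_for_sort)
  then show ?thesis by simp
qed

lemma partition_of_mset:
  assumes "\<And>i. i \<in># M \<Longrightarrow> 0 < i"
  obtains lam where "lam \<in> partitions (\<Sum>\<^sub># M)" "mset lam = M"
proof
  let ?lam = "rev (sorted_list_of_multiset M)"
  show "mset ?lam = M" by simp
  then have "sum_list ?lam = \<Sum>\<^sub># M" by (metis sum_mset_sum_list)
  moreover have "sorted_wrt (\<ge>) ?lam"
    using sorted_sorted_list_of_multiset[of M] by (simp add: sorted_wrt_rev)
  moreover have "\<forall>i\<in>set ?lam. 0 < i" using assms by simp
  ultimately show "?lam \<in> partitions (\<Sum>\<^sub># M)" by (simp add: partitions_def)
qed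

lemma finite_partitions: "finite (partitions n)"
proof (rule finite_subset)
  show "partitions n \<subseteq> {xs. set xs \<subseteq> {..n} \<and> length xs \<le> n}"
  proof
    fix lam assume lam: "lam \<in> partitions n"
    have "length lam \<le> sum_list lam" if "\<forall>i\<in>set lam. 0 < i" for lam :: "nat list"
      using that by (induction lam) auto
    with lam show "lam \<in> {xs. set xs \<subseteq> {..n} \<and> length xs \<le> n}"
      by (auto simp: partitions_def member_le_sum_list)
  qed
  show "finite {xs. set xs \<subseteq> {..n} \<and> length xs \<le> n}"
    by (rule finite_lists_length_le) simp
qed

lemma finite_Hchrom_partitions: "finite (Hchrom_partitions G H)"
  unfolding Hchrom_partitions_def using finite_partitions by simp

lemma finite_exponents_monomials:
  "finite {a. Poly_Mapping.keys a \<subseteq> {..<N} \<and> exponents a = M}"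
proof (rule finite_imageD)
  show "inj_on Poly_Mapping.lookup {a. Poly_Mapping.keys a \<subseteq> {..<N} \<and> exponents a = M}"
    by (rule inj_onI) (simp only: poly_mapping_eq_iff)
  show "finite (Poly_Mapping.lookup ` {a. Poly_Mapping.keys a \<subseteq> {..<N} \<and> exponents a = M})"
  proof (rule finite_subset)
    show "Poly_Mapping.lookup ` {a. Poly_Mapping.keys a \<subseteq> {..<N} \<and> exponents a = M}
      \<subseteq> {f. \<forall>x. (x \<in> {..<N} \<longrightarrow> f x \<in> insert 0 (set_mset M)) \<and> (x \<notin> {..<N} \<longrightarrow> f x = 0)}"
    proof (intro image_subsetI CollectI allI conjI impI)
      fix a x assume "a \<in> {a. Poly_Mapping.keys a \<subseteq> {..<N} \<and> exponents a = M}"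
      then have k: "Poly_Mapping.keys a \<subseteq> {..<N}" and M: "M = exponents a" by auto
      show "Poly_Mapping.lookup a x \<in> insert 0 (set_mset M)"
        by (cases "x \<in> Poly_Mapping.keys a") (simp_all add: M exponents_def in_keys_iff)
      show "Poly_Mapping.lookup a x = 0" if "x \<notin> {..<N}"
        using k that by (meson not_in_keys_iff_lookup_eq_zero subsetD)
    qed
    show "finite {f. \<forall>x. (x \<in> {..<N} \<longrightarrow> f x \<in> insert 0 (set_mset M)) \<and> (x \<notin> {..<N} \<longrightarrow> f x = 0)}"
      by (rule finite_set_of_finite_funs) auto
  qed
qed

lemma lookup_monomial_sp:
  "Poly_Mapping.lookup (monomial_sp N lam) a =
     (if Poly_Mapping.keys a \<subseteq> {..<N} \<and> exponents a = mset lam then 1 else 0)"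
proof -
  let ?S = "{a. Poly_Mapping.keys a \<subseteq> {..<N} \<and> exponents a = mset lam}"
  have "Poly_Mapping.lookup (monomial_sp N lam) a = (\<Sum>b\<in>?S. if b = a then 1 else 0)"
    by (simp add: monomial_sp_def lookup_sum lookup_single when_def)
  also have "\<dots> = (if a \<in> ?S then 1 else 0)"
    by (simp only: sum.delta[OF finite_exponents_monomials])
  finally show ?thesis by simp
qed

lemma lookup_Const_mult:
  "Poly_Mapping.lookup (Const c * p) a = c * Poly_Mapping.lookup p a"
  unfolding Const_def mult_map_scale_conv_mult[symmetric]
  by (simp add: Poly_Mapping.map.rep_eq when_def)

lemma lookup_monomial_expansion:
  "Poly_Mapping.lookup (\<Sum>lam\<in>I. Const (c lam) * monomial_sp N lam) a =
     (\<Sum>lam\<in>I. if Poly_Mapping.keys a \<subseteq> {..<N} \<and> exponents a = mset lam then c lam else 0)"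
  by (auto simp: lookup_sum lookup_Const_mult lookup_monomial_sp intro!: sum.cong)

definition content :: "'a set \<Rightarrow> ('a \<Rightarrow> nat) \<Rightarrow> monomial" where
  "content V kap = (\<Sum>v\<in>V. Poly_Mapping.single (kap v) 1)"

lemma prod_Var:
  assumes "finite V"
  shows "(\<Prod>v\<in>V. Var (kap v)) = Poly_Mapping.single (content V kap) 1"
  using assms
  by (induction V) (simp_all add: content_def Var_def mult_single)

lemma lookup_content:
  assumes "finite V"
  shows "Poly_Mapping.lookup (content V kap) i = card {v\<in>V. kap v = i}"
proof -
  have "Poly_Mapping.lookup (content V kap) i = (\<Sum>v\<in>V. if kap v = i then 1 else 0)"
    unfolding content_def lookup_sum lookup_single when_def ..
  also have "\<dots> = card {v\<in>V. kap v = i}"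
    using assms by (simp add: sum.If_cases Int_def)
  finally show ?thesis .
qed

lemma keys_content:
  assumes "finite V"
  shows "Poly_Mapping.keys (content V kap) = kap ` V"
  using assms by (auto simp: in_keys_iff lookup_content card_eq_0_iff)

lemma mon_degree_content:
  assumes "finite V"
  shows "mon_degree (content V kap) = card V"
proof -
  have "card V = (\<Sum>i\<in>kap ` V. card {v\<in>V. kap v = i})"
    using sum.image_gen[OF assms, of "\<lambda>_. 1::nat" kap] by simp
  then show ?thesis
    by (simp add: mon_degree_def keys_content assms lookup_content)
qed

lemma lookup_Hchrom_poly:
  assumes "finite (pverts G)"
  shows "Poly_Mapping.lookup (Hchrom_poly G H) a =
    (\<Sum>phi\<in>labelings H. \<Sum>kap\<in>proper_colorings G H phi. if content (pverts G) kap = a then 1 else 0)"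
  by (simp add: Hchrom_poly_def prod_Var assms lookup_sum lookup_single when_def)

lemma finite_labelings: "finite (pverts H) \<Longrightarrow> finite (labelings H)"
  unfolding labelings_def by (simp add: finite_PiE)

lemma finite_proper_colorings: "finite (pverts G) \<Longrightarrow> finite (proper_colorings G H phi)"
  unfolding proper_colorings_def by (simp add: finite_PiE)

lemma Hchrom_poly_support:
  assumes G: "finite (pverts G)" and a: "Poly_Mapping.lookup (Hchrom_poly G H) a \<noteq> 0"
  shows "Poly_Mapping.keys a \<subseteq> {..<card (pverts H)}" "mon_degree a = card (pverts G)"
proof -
  obtain phi kap where "kap \<in> proper_colorings G H phi" and c: "content (pverts G) kap = a"
    using a unfolding lookup_Hchrom_poly[OF G]
    by (smt (verit) sum.neutral)
  then have "kap ` pverts G \<subseteq> {..<card (pverts H)}"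
    by (auto simp: proper_colorings_def)
  then show "Poly_Mapping.keys a \<subseteq> {..<card (pverts H)}"
    using c keys_content[OF G] by metis
  show "mon_degree a = card (pverts G)"
    using c mon_degree_content[OF G] by metis
qed

lemma permute_labeling:
  assumes p: "p permutes {..<card (pverts H)}" and phi: "phi \<in> labelings H"
  shows "restrict (p \<circ> phi) (pverts H) \<in> labelings H"
proof -
  have "bij_betw (p \<circ> phi) (pverts H) {..<card (pverts H)}"
    using phi permutes_imp_bij[OF p] by (auto simp: labelings_def intro: bij_betw_trans)
  then have "bij_betw (restrict (p \<circ> phi) (pverts H)) (pverts H) {..<card (pverts H)}"
    by (subst bij_betw_restrict_eq)
  then show ?thesis
    by (auto simp: labelings_def bij_betw_def)
qed

lemma permute_coloring:
  assumes wf: "pair_wf_digraph G" and p: "p permutes {..<card (pverts H)}"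
    and phi: "phi \<in> labelings H" and kap: "kap \<in> proper_colorings G H phi"
  shows "restrict (p \<circ> kap) (pverts G) \<in>
    proper_colorings G H (restrict (p \<circ> phi) (pverts H))"
proof -
  let ?N = "card (pverts H)" and ?phi = "restrict (p \<circ> phi) (pverts H)"
  have inv: "inv_into (pverts H) ?phi (p i) = inv_into (pverts H) phi i" if "i < ?N" for i
  proof -
    have b: "bij_betw phi (pverts H) {..<?N}" and b': "bij_betw ?phi (pverts H) {..<?N}"
      using phi permute_labeling[OF p phi] unfolding labelings_def by blast+
    have "i \<in> phi ` pverts H"
      using bij_betw_imp_surj_on[OF b] that by simp
    then obtain x where x: "x \<in> pverts H" "phi x = i" by blast
    then have "?phi x = p i" by simp
    then have "inv_into (pverts H) ?phi (p i) = x"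
      using b' x by (metis bij_betw_inv_into_left)
    moreover have "inv_into (pverts H) phi i = x"
      using b x by (metis bij_betw_inv_into_left)
    ultimately show ?thesis by simp
  qed
  have kr: "kap v < ?N" if "v \<in> pverts G" for v
    using kap that by (auto simp: proper_colorings_def)
  have arc: "u \<in> pverts G \<and> v \<in> pverts G" if "(u, v) \<in> parcs G" for u v
    using pair_wf_digraph.in_arcsD1[OF wf that] pair_wf_digraph.in_arcsD2[OF wf that] by simp
  have "p (kap v) < ?N" if "v \<in> pverts G" for v
    using kr[OF that] permutes_in_image[OF p] by (metis lessThan_iff)
  moreover have "(inv_into (pverts H) ?phi (p (kap u)), inv_into (pverts H) ?phi (p (kap v))) \<in> parcs H"
    if "(u, v) \<in> parcs G" for u v
    using inv[OF kr] arc[OF that] kap that by (auto simp: proper_colorings_def)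
  ultimately show ?thesis
    using arc by (auto simp: proper_colorings_def)
qed

lemma Hchrom_poly_permute:
  assumes wf: "pair_wf_digraph G" and G: "finite (pverts G)" and H: "finite (pverts H)"
    and p: "p permutes {..<card (pverts H)}"
    and ab: "\<And>i. Poly_Mapping.lookup b (p i) = Poly_Mapping.lookup a i"
  shows "Poly_Mapping.lookup (Hchrom_poly G H) a = Poly_Mapping.lookup (Hchrom_poly G H) b"
proof -
  let ?S = "Sigma (labelings H) (proper_colorings G H)"
  let ?t = "\<lambda>q (phi, kap). (restrict (q \<circ> phi) (pverts H), restrict (q \<circ> kap) (pverts G))"
  have S: "Poly_Mapping.lookup (Hchrom_poly G H) a =
      (\<Sum>(phi, kap)\<in>?S. if content (pverts G) kap = a then 1 else 0)" for a
    unfolding lookup_Hchrom_poly[OF G]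
    by (rule sum.Sigma) (use G H in \<open>auto intro: finite_labelings finite_proper_colorings\<close>)
  have tS: "?t q x \<in> ?S" if "q permutes {..<card (pverts H)}" "x \<in> ?S" for q x
    using that permute_labeling permute_coloring[OF wf] by fastforce
  have tinv: "?t q (?t r x) = x" if "x \<in> ?S" "\<And>i. q (r i) = i" for q r x
    using that
    by (auto simp: labelings_def proper_colorings_def fun_eq_iff PiE_def extensional_def)
  have cont: "content (pverts G) (restrict (p \<circ> kap) (pverts G)) = b \<longleftrightarrow>
      content (pverts G) kap = a" for kap
  proof -
    have "Poly_Mapping.lookup (content (pverts G) (restrict (p \<circ> kap) (pverts G))) (p i) =
      Poly_Mapping.lookup (content (pverts G) kap) i" for i
      unfolding lookup_content[OF G]
      by (rule arg_cong[of _ _ card]) (use permutes_inj[OF p] in \<open>auto dest: injD\<close>)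
    then show ?thesis
      using ab unfolding poly_mapping_eq_iff fun_eq_iff
      by (metis permutes_surj[OF p] surjD)
  qed
  show ?thesis
    unfolding S
  proof (rule sum.reindex_bij_witness[where i = "?t (inv p)" and j = "?t p"])
    fix x assume x: "x \<in> ?S"
    show "?t (inv p) (?t p x) = x" by (rule tinv[OF x]) (rule permutes_inverses(2)[OF p])
    show "?t p (?t (inv p) x) = x" by (rule tinv[OF x]) (rule permutes_inverses(1)[OF p])
    show "?t p x \<in> ?S" by (rule tS[OF p x])
    show "?t (inv p) x \<in> ?S" by (rule tS[OF permutes_inv[OF p] x])
    show "(case ?t p x of (phi, kap) \<Rightarrow> if content (pverts G) kap = b then 1 else 0) =
        (case x of (phi, kap) \<Rightarrow> if content (pverts G) kap = a then 1 else (0::rat))"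
      using cont by (cases x) simp
  qed
qed

lemma exponents_eq_imp_permutes:
  assumes a: "Poly_Mapping.keys a \<subseteq> {..<N}" and b: "Poly_Mapping.keys b \<subseteq> {..<N}"
    and e: "exponents a = exponents b"
  obtains p where "p permutes {..<N}" "\<And>i. Poly_Mapping.lookup b (p i) = Poly_Mapping.lookup a i"
proof -
  have split: "image_mset (Poly_Mapping.lookup c) (mset_set {..<N}) =
      exponents c + replicate_mset (N - size (exponents c)) 0"
    if c: "Poly_Mapping.keys c \<subseteq> {..<N}" for c :: monomial
  proof -
    let ?K = "Poly_Mapping.keys c"
    have "mset_set {..<N} = mset_set ?K + mset_set ({..<N} - ?K)"
      using c by (subst mset_set_Union[symmetric]) (auto intro: arg_cong[of _ _ mset_set])
    moreover have "image_mset (Poly_Mapping.lookup c) (mset_set ({..<N} - ?K)) =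
        image_mset (\<lambda>_. 0) (mset_set ({..<N} - ?K))"
      by (rule image_mset_cong) (auto simp: in_keys_iff)
    moreover have "card ({..<N} - ?K) = N - card ?K"
      using c by (simp add: card_Diff_subset)
    ultimately show ?thesis
      by (simp add: exponents_def image_mset_const_eq)
  qed
  have "image_mset (Poly_Mapping.lookup a) (mset_set {..<N}) =
      image_mset (Poly_Mapping.lookup b) (mset_set {..<N})"
    unfolding split[OF a] split[OF b] e ..
  then obtain p where p: "p permutes {..<N}"
    and eq: "\<forall>i\<in>{..<N}. Poly_Mapping.lookup a i = Poly_Mapping.lookup b (p i)"
    using image_mset_eq_implies_permutes[of "{..<N}"] by blast
  have "Poly_Mapping.lookup b (p i) = Poly_Mapping.lookup a i" for i
  proof (cases "i < N")
    case False
    then have "p i = i" using p by (simp add: permutes_def)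
    moreover have "i \<notin> Poly_Mapping.keys a" "i \<notin> Poly_Mapping.keys b"
      using a b False by auto
    ultimately show ?thesis by (simp add: in_keys_iff)
  qed (use eq in simp)
  with p that show ?thesis by blast
qed

theorem ex1_Hchrom_coeff:
  assumes "pair_graph G" and "pair_graph H"
  shows "\<exists>!c. (\<forall>lam. lam \<notin> Hchrom_partitions G H \<longrightarrow> c lam = 0) \<and>
    Hchrom_poly G H =
      (\<Sum>lam\<in>Hchrom_partitions G H. Const (c lam) * monomial_sp (card (pverts H)) lam)"
proof -
  interpret G: pair_graph G by fact
  interpret H: pair_graph H by fact
  let ?N = "card (pverts H)" and ?I = "Hchrom_partitions G H" and ?w = "Hchrom_poly G H"
  have G: "finite (pverts G)" and H: "finite (pverts H)" and wf: "pair_wf_digraph G"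
    by (auto intro: G.pair_wf_digraph_axioms)
  have lk: "Poly_Mapping.lookup (\<Sum>lam\<in>?I. Const (c lam) * monomial_sp ?N lam) a = c mu"
    if "mu \<in> ?I" "Poly_Mapping.keys a \<subseteq> {..<?N}" "exponents a = mset mu" for c a mu
  proof -
    have "(\<Sum>lam\<in>?I. if Poly_Mapping.keys a \<subseteq> {..<?N} \<and> exponents a = mset lam then c lam else 0) =
        (\<Sum>lam\<in>?I. if lam = mu then c lam else 0)"
      using that by (intro sum.cong) (auto simp: Hchrom_partitions_def dest: partition_mset_inj)
    then show ?thesis
      using that(1) by (simp add: lookup_monomial_expansion sum.delta[OF finite_Hchrom_partitions])
  qed
  have rep: "Poly_Mapping.keys (Poly_Mapping.nth mu) \<subseteq> {..<?N} \<and>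
      exponents (Poly_Mapping.nth mu) = mset mu" if "mu \<in> ?I" for mu
  proof -
    have k: "Poly_Mapping.keys (Poly_Mapping.nth mu) = {..<length mu}"
      using that
      by (auto simp: Hchrom_partitions_def partitions_def nth_default_def in_keys_iff
          simp del: keys_nth split: if_splits)
    have "image_mset (nth_default 0 mu) (mset_set {..<length mu}) =
        image_mset ((!) mu) (mset_set {..<length mu})"
      by (rule image_mset_cong) (auto simp: nth_default_def)
    also have "\<dots> = mset mu"
      by (metis map_nth mset_map mset_upt atLeast0LessThan)
    finally show ?thesis
      using k that by (auto simp: exponents_def Hchrom_partitions_def)
  qed
  define c where "c mu = (if mu \<in> ?I then Poly_Mapping.lookup ?w (Poly_Mapping.nth mu) else 0)" for mu
  have "?w = (\<Sum>lam\<in>?I. Const (c lam) * monomial_sp ?N lam)" (is "_ = ?R")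
  proof (rule poly_mapping_eqI)
    fix a
    show "Poly_Mapping.lookup ?w a = Poly_Mapping.lookup ?R a"
    proof (cases "Poly_Mapping.keys a \<subseteq> {..<?N} \<and> mon_degree a = card (pverts G)")
      case True
      obtain mu where mu: "mu \<in> partitions (\<Sum>\<^sub># (exponents a))" "mset mu = exponents a"
        using partition_of_mset exponents_pos by metis
      have "length mu = card (Poly_Mapping.keys a)"
        using mu(2) by (metis size_exponents size_mset)
      also have "\<dots> \<le> ?N" using True by (metis card_lessThan card_mono finite_lessThan)
      finally have I: "mu \<in> ?I"
        using mu True by (simp add: Hchrom_partitions_def sum_mset_exponents)
      obtain p where "p permutes {..<?N}"
        "\<And>i. Poly_Mapping.lookup (Poly_Mapping.nth mu) (p i) = Poly_Mapping.lookup a i"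
        using exponents_eq_imp_permutes[of a ?N "Poly_Mapping.nth mu"] True rep[OF I] mu(2) by metis
      then have "Poly_Mapping.lookup ?w a = Poly_Mapping.lookup ?w (Poly_Mapping.nth mu)"
        by (rule Hchrom_poly_permute[OF wf G H])
      also have "\<dots> = c mu" using I by (simp add: c_def)
      also have "\<dots> = Poly_Mapping.lookup ?R a"
        using lk[OF I] True mu(2) by simp
      finally show ?thesis .
    next
      case False
      then have "Poly_Mapping.lookup ?w a = 0"
        using Hchrom_poly_support[OF G] by blast
      moreover have "mset lam \<noteq> exponents a" if "lam \<in> ?I" "Poly_Mapping.keys a \<subseteq> {..<?N}" for lam
      proof
        assume "mset lam = exponents a"
        then have "sum_list lam = mon_degree a"
          by (metis sum_mset_exponents sum_mset_sum_list)
        with that False show False by (auto simp: Hchrom_partitions_def partitions_def)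
      qed
      then have "Poly_Mapping.lookup ?R a = 0"
        unfolding lookup_monomial_expansion by (intro sum.neutral) (metis (full_types))
      ultimately show ?thesis by simp
    qed
  qed
  moreover have "d = c" if "\<forall>lam. lam \<notin> ?I \<longrightarrow> d lam = 0"
    "?w = (\<Sum>lam\<in>?I. Const (d lam) * monomial_sp ?N lam)" for d
  proof
    fix mu
    show "d mu = c mu"
    proof (cases "mu \<in> ?I")
      case True
      then have "d mu = Poly_Mapping.lookup ?w (Poly_Mapping.nth mu)"
        using lk[OF True, of "Poly_Mapping.nth mu" d] rep[OF True] that(2) by metis
      then show ?thesis using True by (simp add: c_def)
    qed (use that(1) in \<open>simp add: c_def\<close>)
  qed
  ultimately show ?thesis
    by (intro ex1I[of _ c]) (auto simp: c_def)
qed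

end

theory Submission
  imports Defs
begin

text \<open>
  A proper coloring of \<open>K\<^sub>\<lambda>\<close> with \<open>l(\<lambda>)\<close> colors gives disjoint nonempty color sets to the
  \<open>l(\<lambda>)\<close> parts, so every part is monochromatic and every monomial of the polynomial has exponents
  \<open>\<lambda>\<close>.  Hence each function in the family is a nonzero multiple of a monomial symmetric function,
  and the monomial symmetric functions form a basis.
\<close>

section \<open>Exponent multisets and monomial symmetric functions\<close>

text \<open>\<open>Poly_Mapping.nth mu\<close> serves as the canonical monomial of shape
  \<open>mu\<close>, at which coefficients are read off below. Positivity of the parts makes every
  position of the list a key.\<close>

lemma exponents_nth:
  assumes "mu \<in> partitions n"
  shows "Poly_Mapping.keys (Poly_Mapping.nth mu) = {..<length mu}"
    and "exponents (Poly_Mapping.nth mu) = mset mu"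
proof -
  show k: "Poly_Mapping.keys (Poly_Mapping.nth mu) = {..<length mu}"
    using assms
    by (auto simp: partitions_def nth_default_def in_keys_iff simp del: keys_nth split: if_splits)
  have "image_mset (nth_default 0 mu) (mset_set {..<length mu}) =
      image_mset ((!) mu) (mset_set {..<length mu})"
    by (rule image_mset_cong) (auto simp: nth_default_def)
  also have "\<dots> = mset mu"
    by (metis map_nth mset_map mset_upt atLeast0LessThan)
  finally show "exponents (Poly_Mapping.nth mu) = mset mu"
    using k by (simp add: exponents_def)
qed

text \<open>\<open>map_key p\<close> composes the exponent function with \<open>p\<close>, so its
  keys are the preimage under \<open>p\<close>. Surjectivity carries this preimage back onto all
  keys of \<open>a\<close>, and injectivity keeps multiplicities. This gives the symmetry of
  \<open>monomial_sf\<close>.\<close>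

lemma exponents_map_key:
  assumes "bij p"
  shows "exponents (Poly_Mapping.map_key p a) = exponents a"
proof -
  have inj: "inj p" using assms by (rule bij_is_inj)
  have "image_mset p (mset_set (p -` Poly_Mapping.keys a)) = mset_set (p ` (p -` Poly_Mapping.keys a))"
    by (rule image_mset_mset_set) (rule inj_on_subset[OF inj], simp)
  also have "p ` (p -` Poly_Mapping.keys a) = Poly_Mapping.keys a"
    using assms by (simp add: bij_is_surj surj_image_vimage_eq)
  finally have "image_mset (Poly_Mapping.lookup a) (image_mset p (mset_set (p -` Poly_Mapping.keys a)))
      = exponents a"
    by (simp add: exponents_def)
  moreover have "Poly_Mapping.keys (Poly_Mapping.map_key p a) = p -` Poly_Mapping.keys a"
    by (rule keys_map_key[OF inj])
  moreover have "Poly_Mapping.lookup (Poly_Mapping.map_key p a) = Poly_Mapping.lookup a \<circ> p"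
    using inj by (simp add: map_key.rep_eq)
  ultimately show ?thesis
    by (simp add: exponents_def multiset.map_comp)
qed

lemma monomial_sf_in_Sym_hom:
  assumes "lam \<in> partitions n"
  shows "monomial_sf lam \<in> Sym_hom n"
proof -
  have "mon_degree a = n" if "exponents a = mset lam" for a
    using assms that sum_mset_exponents[of a] by (simp add: partitions_def sum_mset_sum_list)
  then show ?thesis
    by (simp add: Sym_hom_def monomial_sf_def exponents_map_key)
qed

text \<open>Two monomials have finite supports in a common range \<open>{..<N}\<close>, where equal
  exponents yield a permutation between them. Being the identity elsewhere, it is a bijection of all
  variables, under which \<open>f\<close> is invariant.\<close>

lemma Sym_hom_exponents_cong:
  assumes f: "f \<in> Sym_hom n" and e: "exponents a = exponents b"
  shows "f a = f b"
proof -
  have "finite (Poly_Mapping.keys a \<union> Poly_Mapping.keys b)" by simp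
  then obtain N where N: "Poly_Mapping.keys a \<union> Poly_Mapping.keys b \<subseteq> {..<N}"
    by (metis finite_nat_iff_bounded)
  then obtain p where p: "p permutes {..<N}"
    and eq: "\<And>i. Poly_Mapping.lookup b (p i) = Poly_Mapping.lookup a i"
    using exponents_eq_imp_permutes[of a N b] e by auto
  have "Poly_Mapping.map_key p b = a"
    by (rule poly_mapping_eqI) (simp add: map_key.rep_eq permutes_inj[OF p] eq)
  then show ?thesis
    using f permutes_bij[OF p] by (auto simp: Sym_hom_def)
qed

section \<open>Bases of nonzero multiples of monomial symmetric functions\<close>

text \<open>Distinct partitions give functions with disjoint supports, so evaluation at one monomial
  of each shape isolates each coefficient.\<close>

lemma scaled_monomial_sf_basis:
  fixes c :: "nat list \<Rightarrow> rat"
  assumes c: "\<And>lam. lam \<in> partitions n \<Longrightarrow> c lam \<noteq> 0"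
  defines "X \<equiv> \<lambda>lam. sf_scale (c lam) (monomial_sf lam)"
  shows "sf.independent (X ` partitions n)" and "sf.span (X ` partitions n) = Sym_hom n"
proof -
  have X: "X lam a = (if mu = lam then c mu else 0)"
    if "lam \<in> partitions n" "mu \<in> partitions n" "exponents a = mset mu" for lam mu a
    using that by (auto simp: X_def sf_scale_def monomial_sf_def dest: partition_mset_inj)
  \<comment> \<open>Only the term of \<open>mu\<close> survives at a monomial of shape
    \<open>mu\<close>. Both independence and spanning rest on this evaluation.\<close>
  have comb: "(\<Sum>lam\<in>partitions n. sf_scale (d lam) (X lam)) a = d mu * c mu"
    if "mu \<in> partitions n" "exponents a = mset mu" for d mu a
  proof -
    have "(\<Sum>lam\<in>partitions n. sf_scale (d lam) (X lam)) a =
        (\<Sum>lam\<in>partitions n. d lam * X lam a)"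
      using finite_partitions by (induction rule: finite_induct) (simp_all add: sf_scale_def)
    also have "\<dots> = (\<Sum>lam\<in>partitions n. if lam = mu then d mu * c mu else 0)"
      by (rule sum.cong) (auto simp: X[OF _ that])
    finally show ?thesis
      using that by (simp add: finite_partitions)
  qed
  \<comment> \<open>Independence concerns the set of functions, while \<open>comb\<close> sums over
    partitions; injectivity permits the reindexing.\<close>
  have inj: "inj_on X (partitions n)"
  proof (rule inj_onI)
    fix lam mu assume *: "lam \<in> partitions n" "mu \<in> partitions n" "X lam = X mu"
    then have "X lam (Poly_Mapping.nth lam) = X mu (Poly_Mapping.nth lam)" by simp
    then show "lam = mu"
      using X[OF *(1) *(1) exponents_nth(2)[OF *(1)]] X[OF *(2) *(1) exponents_nth(2)[OF *(1)]]
        c[OF *(1)]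
      by (auto split: if_splits)
  qed
  show "sf.independent (X ` partitions n)"
  proof (rule sf.independent_if_scalars_zero)
    show "finite (X ` partitions n)" by (simp add: finite_partitions)
    fix f x assume z: "(\<Sum>x\<in>X ` partitions n. sf_scale (f x) x) = 0" and "x \<in> X ` partitions n"
    then obtain mu where mu: "mu \<in> partitions n" "x = X mu" by blast
    have "(\<Sum>lam\<in>partitions n. sf_scale (f (X lam)) (X lam)) = 0"
      using z by (simp add: sum.reindex[OF inj])
    then have "f (X mu) * c mu = 0"
      using comb[OF mu(1) exponents_nth(2)[OF mu(1)], of "\<lambda>lam. f (X lam)"] by simp
    then show "f x = 0" using c mu by simp
  qed
  show "sf.span (X ` partitions n) = Sym_hom n"
  proof (rule sf.span_unique)
    show "X ` partitions n \<subseteq> Sym_hom n"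
      by (auto simp: X_def intro: sf.subspace_scale[OF subspace_Sym_hom] monomial_sf_in_Sym_hom)
  next
    show "sf.subspace (Sym_hom n)" by (rule subspace_Sym_hom)
  next
    fix T assume T: "X ` partitions n \<subseteq> T" "sf.subspace T"
    show "Sym_hom n \<subseteq> T"
    proof
      fix f assume f: "f \<in> Sym_hom n"
      \<comment> \<open>The value of \<open>f\<close> at the canonical monomial, divided by
        \<open>c lam\<close> to undo the scaling of \<open>X lam\<close>.\<close>
      define d where "d lam = f (Poly_Mapping.nth lam) / c lam" for lam
      have "f a = (\<Sum>lam\<in>partitions n. sf_scale (d lam) (X lam)) a" for a
      proof -
        obtain mu where mu: "mu \<in> partitions (\<Sum>\<^sub># (exponents a))" "mset mu = exponents a"
          using partition_of_mset exponents_pos by metis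
        show ?thesis
        proof (cases "mon_degree a = n")
          case True
          then have mu': "mu \<in> partitions n" using mu by (simp add: sum_mset_exponents)
          have "f a = f (Poly_Mapping.nth mu)"
            by (rule Sym_hom_exponents_cong[OF f]) (simp add: exponents_nth(2)[OF mu'] mu)
          then show ?thesis
            using comb[OF mu' mu(2)[symmetric]] c[OF mu'] by (simp add: d_def)
        next
          \<comment> \<open>Outside degree \<open>n\<close> both sides vanish by
            homogeneity.\<close>
          case False
          have "(\<Sum>lam\<in>partitions n. sf_scale (d lam) (X lam)) \<in> Sym_hom n"
            by (intro sf.subspace_sum[OF subspace_Sym_hom] sf.subspace_scale[OF subspace_Sym_hom])
               (auto simp: X_def intro: sf.subspace_scale[OF subspace_Sym_hom] monomial_sf_in_Sym_hom)
          with f False have "f a = 0" "(\<Sum>lam\<in>partitions n. sf_scale (d lam) (X lam)) a = 0"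
            unfolding Sym_hom_def by blast+
          then show ?thesis by simp
        qed
      qed
      then have "f = (\<Sum>lam\<in>partitions n. sf_scale (d lam) (X lam))" by (rule ext)
      also have "\<dots> \<in> T"
        by (intro sf.subspace_sum[OF T(2)] sf.subspace_scale[OF T(2)]) (use T(1) in auto)
      finally show "f \<in> T" .
    qed
  qed
qed

section \<open>Coefficients of \<open>H\<close>-chromatic symmetric functions\<close>

text \<open>Existence and uniqueness turn the description by \<open>THE\<close> into an actual
  expansion. Comparing coefficients at \<open>a\<close> leaves the term of \<open>mu\<close> alone,
  since a partition is determined by its multiset of parts.\<close>

lemma Hchrom_coeff_eq_lookup:
  assumes "pair_graph G" "pair_graph H" and mu: "mu \<in> Hchrom_partitions G H"
    and a: "Poly_Mapping.keys a \<subseteq> {..<card (pverts H)}" "exponents a = mset mu"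
  shows "Hchrom_coeff G H mu = Poly_Mapping.lookup (Hchrom_poly G H) a"
proof -
  let ?I = "Hchrom_partitions G H" and ?c = "Hchrom_coeff G H"
  have "Hchrom_poly G H = (\<Sum>lam\<in>?I. Const (?c lam) * monomial_sp (card (pverts H)) lam)"
    using theI'[OF ex1_Hchrom_coeff[OF assms(1,2)]] by (simp flip: Hchrom_coeff_def)
  then have "Poly_Mapping.lookup (Hchrom_poly G H) a =
      (\<Sum>lam\<in>?I. if Poly_Mapping.keys a \<subseteq> {..<card (pverts H)} \<and> exponents a = mset lam
        then ?c lam else 0)"
    by (simp only: lookup_monomial_expansion)
  also have "\<dots> = (\<Sum>lam\<in>?I. if lam = mu then ?c lam else 0)"
    using mu a by (intro sum.cong) (auto simp: Hchrom_partitions_def dest: partition_mset_inj)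
  finally show ?thesis
    using mu by (simp add: finite_Hchrom_partitions)
qed

text \<open>Coefficients count pairs of a labeling and a coloring. If every such pair yields
  exponents \<open>lam\<close>, all other coefficients vanish; one existing pair makes the remaining
  one nonzero.\<close>

lemma Hchrom_sf_single_exponents:
  assumes G: "pair_graph G" and H: "pair_graph H"
    and lam: "lam \<in> partitions n"
    and exps: "\<And>phi kap. phi \<in> labelings H \<Longrightarrow> kap \<in> proper_colorings G H phi \<Longrightarrow>
      exponents (content (pverts G) kap) = mset lam"
    and ex: "phi0 \<in> labelings H" "kap0 \<in> proper_colorings G H phi0"
  obtains c where "c \<noteq> 0" "Hchrom_sf G H = sf_scale c (monomial_sf lam)"
proof -
  interpret G: pair_graph G by fact
  interpret H: pair_graph H by fact
  have fin: "finite (pverts G)" "finite (pverts H)" by auto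
  let ?I = "Hchrom_partitions G H" and ?w = "Hchrom_poly G H"
  let ?a = "content (pverts G) kap0"
  have ea: "exponents ?a = mset lam" using exps ex by blast
  have ka: "Poly_Mapping.keys ?a \<subseteq> {..<card (pverts H)}"
    using ex by (auto simp: keys_content[OF fin(1)] proper_colorings_def)
  \<comment> \<open>The size and length bounds that place \<open>lam\<close> in the index set are
    read off from the content of the witness \<open>kap0\<close>.\<close>
  have "sum_list lam = card (pverts G)"
    using ea sum_mset_exponents[of ?a] mon_degree_content[OF fin(1), of kap0]
    by (simp add: sum_mset_sum_list)
  moreover have "length lam \<le> card (pverts H)"
    using card_mono[OF _ ka] size_exponents[of ?a] ea by simp
  ultimately have lamI: "lam \<in> ?I"
    using lam by (simp add: Hchrom_partitions_def partitions_def)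
  have zero: "Hchrom_coeff G H mu = 0" if mu: "mu \<in> ?I" "mu \<noteq> lam" for mu
  proof -
    have mp: "mu \<in> partitions (card (pverts G))" "length mu \<le> card (pverts H)"
      using mu by (auto simp: Hchrom_partitions_def)
    have "Hchrom_coeff G H mu = Poly_Mapping.lookup ?w (Poly_Mapping.nth mu)"
      by (rule Hchrom_coeff_eq_lookup[OF G H mu(1)])
         (use exponents_nth[OF mp(1)] mp(2) in auto)
    also have "\<dots> = 0"
      unfolding lookup_Hchrom_poly[OF fin(1)]
    proof (intro sum.neutral ballI)
      fix phi kap assume "phi \<in> labelings H" "kap \<in> proper_colorings G H phi"
      then have "exponents (content (pverts G) kap) = mset lam" by (rule exps)
      moreover have "mset mu \<noteq> mset lam"
        using mu lam mp(1) partition_mset_inj by blast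
      ultimately show "(if content (pverts G) kap = Poly_Mapping.nth mu then 1 else 0) = (0::rat)"
        using exponents_nth(2)[OF mp(1)] by auto
    qed
    finally show ?thesis .
  qed
  \<comment> \<open>All summands are 0 or 1, so nothing cancels the contribution of
    \<open>phi0\<close> and \<open>kap0\<close>.\<close>
  have "0 < Poly_Mapping.lookup ?w ?a"
    unfolding lookup_Hchrom_poly[OF fin(1)]
    by (intro sum_pos2[OF finite_labelings[OF fin(2)] ex(1)]
          sum_pos2[OF finite_proper_colorings[OF fin(1)] ex(2)] sum_nonneg) auto
  then have "Hchrom_coeff G H lam \<noteq> 0"
    using Hchrom_coeff_eq_lookup[OF G H lamI ka ea] by simp
  moreover have "Hchrom_sf G H = (\<Sum>mu\<in>?I. if mu = lam
      then sf_scale (Hchrom_coeff G H lam) (monomial_sf lam) else 0)"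
    unfolding Hchrom_sf_def by (rule sum.cong) (auto simp: zero)
  then have "Hchrom_sf G H = sf_scale (Hchrom_coeff G H lam) (monomial_sf lam)"
    using lamI by (simp add: finite_Hchrom_partitions)
  ultimately show ?thesis by (rule that)
qed

section \<open>Proper colorings with a complete graph of colors\<close>

lemma pair_wf_digraph_of_pair_graph:
  assumes "pair_graph G"
  shows "pair_wf_digraph G"
proof -
  interpret pair_graph G by fact
  show ?thesis by (rule pair_wf_digraph_axioms)
qed

lemma pverts_complete_graph: "pverts (complete_graph k) = {..<k}"
  by (simp add: complete_graph_def)

lemma identity_labeling: "restrict id {..<k} \<in> labelings (complete_graph k)"
  by (auto simp: labelings_def pverts_complete_graph bij_betw_def inj_on_def image_def)

text \<open>Adjacency in a complete graph is distinctness, which the inverse of a bijective labeling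
  preserves and reflects. So the labeling does not matter and ordinary proper colorings
  remain.\<close>

lemma proper_coloring_complete_graph_iff:
  assumes wf: "pair_wf_digraph G" and phi: "phi \<in> labelings (complete_graph k)"
  shows "kap \<in> proper_colorings G (complete_graph k) phi \<longleftrightarrow>
    kap \<in> pverts G \<rightarrow>\<^sub>E {..<k} \<and> (\<forall>(u, v) \<in> parcs G. kap u \<noteq> kap v)"
proof -
  have b: "bij_betw (inv_into {..<k} phi) {..<k} {..<k}"
    using phi by (intro bij_betw_inv_into) (simp add: labelings_def pverts_complete_graph)
  have adj: "(inv_into {..<k} phi i, inv_into {..<k} phi j) \<in> parcs (complete_graph k) \<longleftrightarrow> i \<noteq> j"
    if "i < k" "j < k" for i j
  proof -
    have "inv_into {..<k} phi i < k" "inv_into {..<k} phi j < k"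
      using bij_betw_apply[OF b] that by auto
    moreover have "inv_into {..<k} phi i = inv_into {..<k} phi j \<longleftrightarrow> i = j"
      using bij_betw_imp_inj_on[OF b] that by (auto simp: inj_on_eq_iff)
    ultimately show ?thesis by (simp add: complete_graph_def)
  qed
  have arc: "(inv_into {..<k} phi (kap u), inv_into {..<k} phi (kap v)) \<in> parcs (complete_graph k)
      \<longleftrightarrow> kap u \<noteq> kap v" if "kap \<in> pverts G \<rightarrow>\<^sub>E {..<k}" "(u, v) \<in> parcs G" for u v
    using pair_wf_digraph.in_arcsD1[OF wf that(2)] pair_wf_digraph.in_arcsD2[OF wf that(2)] that(1)
    by (intro adj) auto
  show ?thesis
    unfolding proper_colorings_def pverts_complete_graph
    using arc by (fastforce simp: pverts_complete_graph)
qed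

text \<open>Pigeonhole on one representative per part: their colors are pairwise distinct and as
  many as the available colors, hence exhaust them. The color classes are then exactly the
  parts.\<close>

lemma exponents_content_multipartite:
  assumes lam: "lam \<in> partitions n" and V: "V = Sigma {..<length lam} (\<lambda>i. {..<lam ! i})"
    and kap: "kap \<in> V \<rightarrow> {..<length lam}"
    and proper: "\<And>u v. u \<in> V \<Longrightarrow> v \<in> V \<Longrightarrow> fst u \<noteq> fst v \<Longrightarrow> kap u \<noteq> kap v"
  shows "exponents (content V kap) = mset lam"
proof -
  let ?k = "length lam"
  \<comment> \<open>The color of the representative \<open>(i, 0)\<close> of part \<open>i\<close>,
    which exists because the parts of a partition are positive.\<close>
  define g where "g i = kap (i, 0)" for i
  have pos: "0 < lam ! i" if "i < ?k" for i
    using lam that by (simp add: partitions_def)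
  have rep: "(i, 0) \<in> V" if "i < ?k" for i using that pos V by simp
  have inj: "inj_on g {..<?k}"
    unfolding g_def by (rule inj_onI) (metis fst_conv lessThan_iff proper rep)
  have "g ` {..<?k} \<subseteq> {..<?k}" using kap rep by (auto simp: g_def)
  then have img: "g ` {..<?k} = {..<?k}"
    using inj by (simp add: endo_inj_surj)
  \<comment> \<open>The color of \<open>v\<close> is some \<open>g i\<close>. If \<open>i\<close>
    were not \<open>fst v\<close>, then \<open>v\<close> and \<open>(i, 0)\<close> would lie in
    different parts yet share a color.\<close>
  have mono: "kap v = g (fst v)" if "v \<in> V" for v
  proof -
    have "kap v \<in> g ` {..<?k}" using kap that img by auto
    then obtain i where "i < ?k" "kap v = g i" by auto
    then show ?thesis using proper[OF that rep] by (metis fst_conv g_def)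
  qed
  have fin: "finite V" by (simp add: V)
  have "Poly_Mapping.lookup (content V kap) (g i) = lam ! i" if "i < ?k" for i
  proof -
    have "{v \<in> V. kap v = g i} = Pair i ` {..<lam ! i}"
      using that inj by (auto simp: mono V inj_on_eq_iff)
    then show ?thesis by (simp add: lookup_content[OF fin] card_image inj_on_def)
  qed
  then have look: "image_mset (Poly_Mapping.lookup (content V kap) \<circ> g) (mset_set {..<?k}) =
      image_mset ((!) lam) (mset_set {..<?k})"
    by (intro image_mset_cong) simp
  have "kap ` V = g ` {..<?k}"
  proof
    show "kap ` V \<subseteq> g ` {..<?k}" using mono V by auto
    show "g ` {..<?k} \<subseteq> kap ` V" using rep by (auto simp: g_def)
  qed
  then have "mset_set (Poly_Mapping.keys (content V kap)) = image_mset g (mset_set {..<?k})"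
    by (simp only: keys_content[OF fin] image_mset_mset_set[OF inj])
  then have "exponents (content V kap) = image_mset ((!) lam) (mset_set {..<?k})"
    by (simp add: exponents_def multiset.map_comp look)
  also have "\<dots> = mset lam"
    by (metis map_nth mset_map mset_upt atLeast0LessThan)
  finally show ?thesis .
qed

section \<open>The members of the family and the resulting basis\<close>

lemma Hchrom_sf_complete_multipartite:
  assumes lam: "lam \<in> partitions n"
  obtains c where "c \<noteq> 0"
    "Hchrom_sf (complete_multipartite_graph lam) (complete_graph (length lam)) =
      sf_scale c (monomial_sf lam)"
proof -
  let ?G = "complete_multipartite_graph lam" and ?k = "length lam"
  let ?V = "pverts ?G"
  have wf: "pair_wf_digraph ?G"
    by (rule pair_wf_digraph_of_pair_graph[OF pair_graph_complete_multipartite_graph])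
  have arcs: "(u, v) \<in> parcs ?G \<longleftrightarrow> u \<in> ?V \<and> v \<in> ?V \<and> fst u \<noteq> fst v" for u v
    by (simp add: complete_multipartite_graph_def Let_def)
  show ?thesis
  proof (rule Hchrom_sf_single_exponents[OF pair_graph_complete_multipartite_graph
        pair_graph_complete_graph lam _ identity_labeling _ that])
    fix phi kap
    assume phi: "phi \<in> labelings (complete_graph ?k)"
      and "kap \<in> proper_colorings ?G (complete_graph ?k) phi"
    then have "kap \<in> ?V \<rightarrow>\<^sub>E {..<?k}" "\<And>u v. (u, v) \<in> parcs ?G \<Longrightarrow> kap u \<noteq> kap v"
      unfolding proper_coloring_complete_graph_iff[OF wf phi] by auto
    then show "exponents (content ?V kap) = mset lam"
      by (intro exponents_content_multipartite[OF lam complete_multipartite_verts])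
         (auto simp: arcs)
  next
    \<comment> \<open>The witness colors each vertex by the index of its part.\<close>
    show "restrict fst ?V \<in> proper_colorings ?G (complete_graph ?k) (restrict id {..<?k})"
      unfolding proper_coloring_complete_graph_iff[OF wf identity_labeling]
      by (auto simp: arcs complete_multipartite_verts)
  qed
qed

text \<open>With a single color only the constant coloring exists, and its content is the
  \<open>n\<close>-th power of the variable of index 0.\<close>

lemma Hchrom_sf_edgeless:
  assumes n: "n \<ge> 1"
  obtains c where "c \<noteq> 0"
    "Hchrom_sf (edgeless_graph n) (complete_graph 1) = sf_scale c (monomial_sf [n])"
proof -
  let ?G = "edgeless_graph n"
  have V: "pverts ?G = {..<n}" and A: "parcs ?G = {}" by (simp_all add: edgeless_graph_def)
  have wf: "pair_wf_digraph ?G"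
    by (rule pair_wf_digraph_of_pair_graph[OF pair_graph_edgeless_graph])
  show ?thesis
  proof (rule Hchrom_sf_single_exponents[OF pair_graph_edgeless_graph
        pair_graph_complete_graph _ _ identity_labeling _ that])
    show "[n] \<in> partitions n" using n by (simp add: partitions_def)
  next
    fix phi kap
    assume phi: "phi \<in> labelings (complete_graph 1)"
      and "kap \<in> proper_colorings ?G (complete_graph 1) phi"
    then have "kap \<in> {..<n} \<rightarrow>\<^sub>E {..<1}"
      unfolding proper_coloring_complete_graph_iff[OF wf phi] V by simp
    then have k: "kap v = 0" if "v < n" for v using that by auto
    \<comment> \<open>A nonempty vertex set ensures that color 0 occurs, so it is a key of the
      content.\<close>
    have "{..<n} \<noteq> {}" using n by (simp add: lessThan_empty_iff)
    then have "kap ` {..<n} = {0}" using k by (auto simp: image_constant_conv cong: image_cong_simp)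
    moreover have "{v \<in> {..<n}. kap v = 0} = {..<n}" using k by auto
    ultimately show "exponents (content (pverts ?G) kap) = mset [n]"
      by (simp add: exponents_def V keys_content lookup_content)
  next
    show "restrict (\<lambda>_. 0) (pverts ?G) \<in> proper_colorings ?G (complete_graph 1) (restrict id {..<1})"
      unfolding proper_coloring_complete_graph_iff[OF wf identity_labeling] by (auto simp: A)
  qed
qed

theorem proposition7p4:
  fixes n :: nat
  assumes "n \<ge> 1"
  shows "let \<beta> = {Hchrom_sf (complete_multipartite_graph lam) (complete_graph (length lam)) | lam.
                    lam \<in> partitions n \<and> lam \<noteq> [n]}
                  \<union> {Hchrom_sf (edgeless_graph n) (complete_graph 1)}
         in sf.independent \<beta> \<and> sf.span \<beta> = Sym_hom n"
proof -
  \<comment> \<open>\<open>Y\<close> indexes the whole family by \<open>partitions n\<close>, with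
    the edgeless member in the place of \<open>[n]\<close>; the union then becomes an image to which
    the basis lemma applies.\<close>
  define Y where "Y lam = (if lam = [n] then Hchrom_sf (edgeless_graph n) (complete_graph 1)
    else Hchrom_sf (complete_multipartite_graph lam) (complete_graph (length lam)))" for lam
  have "\<exists>c. c \<noteq> 0 \<and> Y lam = sf_scale c (monomial_sf lam)" if "lam \<in> partitions n" for lam
    using Hchrom_sf_edgeless[OF assms] Hchrom_sf_complete_multipartite[OF that]
    unfolding Y_def by metis
  then obtain c where c: "\<And>lam. lam \<in> partitions n \<Longrightarrow> c lam \<noteq> 0"
    and Y: "\<And>lam. lam \<in> partitions n \<Longrightarrow> Y lam = sf_scale (c lam) (monomial_sf lam)"
    by metis
  have "[n] \<in> partitions n" using assms by (simp add: partitions_def)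
  then have "{Hchrom_sf (complete_multipartite_graph lam) (complete_graph (length lam)) | lam.
      lam \<in> partitions n \<and> lam \<noteq> [n]} \<union> {Hchrom_sf (edgeless_graph n) (complete_graph 1)} =
      Y ` partitions n"
    by (auto simp: Y_def image_iff)
  also have "\<dots> = (\<lambda>lam. sf_scale (c lam) (monomial_sf lam)) ` partitions n"
    by (rule image_cong) (simp_all add: Y)
  finally show ?thesis
    using scaled_monomial_sf_basis[of n c, OF c] by (simp add: Let_def)
qed

end
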